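(* Let $0\le a<b$ (with $b=+\infty$ allowed), and let $g$ be a real-valued function defined and finite on $(a,b)$. Let $N\ge 2$ be an integer. If $g$ is an anti-Löwner function of order $2N$ on $(a,b)$, then the function $x\mapsto g(\sqrt{x})\sqrt{x}$ is a non-negative matrix monotone function of order $N$ on $(a^2,b^2)$, and the function $x\mapsto g(\sqrt{x})/\sqrt{x}$ is a non-negative matrix monotone decreasing function of order $N$ on $(a^2,b^2)$.
   Context: Let $0\le a<b\le+\infty$ and let $g:(a,b)\to\mathbb{R}$. For an integer $N\ge1$ and distinct points $x_1,\ldots,x_N\in(a,b)$, the anti-Löwner matrix of $g$ at these points is the $N\times N$ real symmetric matrix $K_g=\left(\frac{g(x_i)+g(x_j)}{x_i+x_j}\right)_{i,j=1}^N$. The function $g$ is called an anti-Löwner function of order $N$ on $(a,b)$ if $K_g$ is positive semidefinite for every choice of $N$ distinct points $x_1,\ldots,x_N$ in $(a,b)$. A real-valued function $f$ on an interval $(c,d)$ is matrix monotone of order $N$ if for any $N\times N$ Hermitian matrices $A,B$ with spectra in $(c,d)$, $A\le B$ implies $f(A)\le f(B)$, where $\le$ is the positive semidefinite ordering and $f(A)$ is defined by functional calculus. It is matrix monotone decreasing of order $N$ if $-f$ is matrix monotone of order $N$. If $b=+\infty$, then $b^2=+\infty$. *)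

theory Defs
  imports
    "HOL-Analysis.Interval_Integral"
    "Jordan_Normal_Form.Spectral_Radius"
    "Jordan_Normal_Form.Schur_Decomposition"
begin

definition hermitian_mat :: "'a::conjugatable_field mat \<Rightarrow> bool" where
  "hermitian_mat A \<longleftrightarrow> square_mat A \<and> mat_adjoint A = A"

(* Used at type real (real symmetric matrices, real test vectors) and at type complex, where
   the order is the one of Complex_Order: 0 \<le> z means that z is real and non-negative. *)
definition psd_mat :: "'a::conjugatable_ordered_field mat \<Rightarrow> bool" where
  "psd_mat A \<longleftrightarrow>
     hermitian_mat A \<and> (\<forall>v\<in>carrier_vec (dim_row A). 0 \<le> (A *\<^sub>v v) \<bullet>c v)"

definition loewner_le :: "'a::conjugatable_ordered_field mat \<Rightarrow> 'a mat \<Rightarrow> bool" where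
  "loewner_le A B \<longleftrightarrow> psd_mat (B - A)"

definition unitary_mat :: "complex mat \<Rightarrow> bool" where
  "unitary_mat U \<longleftrightarrow> square_mat U \<and> mat_adjoint U * U = 1\<^sub>m (dim_row U)"

definition unitary_diagonalization :: "complex mat \<Rightarrow> complex mat \<Rightarrow> (nat \<Rightarrow> real) \<Rightarrow> bool" where
  "unitary_diagonalization A U d \<longleftrightarrow>
     unitary_mat U \<and> dim_row U = dim_row A \<and>
     A = U * mat_diag (dim_row A) (\<lambda>i. complex_of_real (d i)) * mat_adjoint U"

(* Functional calculus f(A) = U diag(f(d_1),...,f(d_n)) U* for any unitary diagonalization
   A = U diag(d_1,...,d_n) U*. The result does not depend on the diagonalization, see
   mat_fun_eq below. For A that is not Hermitian the value is unspecified. *)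
definition mat_fun :: "(real \<Rightarrow> real) \<Rightarrow> complex mat \<Rightarrow> complex mat" where
  "mat_fun f A =
     (THE B. \<exists>U d. unitary_diagonalization A U d \<and>
        B = U * mat_diag (dim_row A) (\<lambda>i. complex_of_real (f (d i))) * mat_adjoint U)"

definition matrix_monotone :: "nat \<Rightarrow> real set \<Rightarrow> (real \<Rightarrow> real) \<Rightarrow> bool" where
  "matrix_monotone N I f \<longleftrightarrow>
     (\<forall>A\<in>carrier_mat N N. \<forall>B\<in>carrier_mat N N.
        hermitian_mat A \<longrightarrow> hermitian_mat B \<longrightarrow>
        spectrum A \<subseteq> complex_of_real ` I \<longrightarrow> spectrum B \<subseteq> complex_of_real ` I \<longrightarrow>
        loewner_le A B \<longrightarrow> loewner_le (mat_fun f A) (mat_fun f B))"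

definition matrix_monotone_decreasing :: "nat \<Rightarrow> real set \<Rightarrow> (real \<Rightarrow> real) \<Rightarrow> bool" where
  "matrix_monotone_decreasing N I f \<longleftrightarrow> matrix_monotone N I (\<lambda>t. - f t)"

definition anti_loewner_mat :: "(real \<Rightarrow> real) \<Rightarrow> nat \<Rightarrow> (nat \<Rightarrow> real) \<Rightarrow> real mat" where
  "anti_loewner_mat g N x = Matrix.mat N N (\<lambda>(i, j). (g (x i) + g (x j)) / (x i + x j))"

(* The N points are x 0, ..., x (N - 1). *)
definition anti_loewner :: "nat \<Rightarrow> real set \<Rightarrow> (real \<Rightarrow> real) \<Rightarrow> bool" where
  "anti_loewner N I g \<longleftrightarrow>
     (\<forall>x. inj_on x {..<N} \<longrightarrow> x ` {..<N} \<subseteq> I \<longrightarrow> psd_mat (anti_loewner_mat g N x))"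

lemma mat_adjoint_carrier:
  "A \<in> carrier_mat n m \<Longrightarrow> mat_adjoint A \<in> carrier_mat m n"
  by (auto simp: mat_adjoint_def)

lemma mat_fun_unique:
  assumes U: "unitary_diagonalization A U d" and V: "unitary_diagonalization A V e"
  shows "U * mat_diag (dim_row A) (\<lambda>i. complex_of_real (f (d i))) * mat_adjoint U =
         V * mat_diag (dim_row A) (\<lambda>i. complex_of_real (f (e i))) * mat_adjoint V"
proof -
  define n where "n = dim_row A"
  define D where "D = mat_diag n (\<lambda>i. complex_of_real (d i))"
  define E where "E = mat_diag n (\<lambda>i. complex_of_real (e i))"
  define fD where "fD = mat_diag n (\<lambda>i. complex_of_real (f (d i)))"
  define fE where "fE = mat_diag n (\<lambda>i. complex_of_real (f (e i)))"
  define Us where "Us = mat_adjoint U"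
  define Vs where "Vs = mat_adjoint V"
  define W where "W = Vs * U"
  have c: "U \<in> carrier_mat n n" "V \<in> carrier_mat n n"
    using U V by (auto simp: unitary_diagonalization_def unitary_mat_def n_def)
  then have cs: "Us \<in> carrier_mat n n" "Vs \<in> carrier_mat n n"
    by (auto simp: Us_def Vs_def intro: mat_adjoint_carrier)
  have cd: "D \<in> carrier_mat n n" "E \<in> carrier_mat n n" "fD \<in> carrier_mat n n" "fE \<in> carrier_mat n n"
    by (auto simp: D_def E_def fD_def fE_def)
  have W: "W \<in> carrier_mat n n" using c cs by (auto simp: W_def)
  note cc = c cs cd W
  have UU: "Us * U = 1\<^sub>m n" and VV: "Vs * V = 1\<^sub>m n"
    using U V by (auto simp: unitary_diagonalization_def unitary_mat_def n_def Us_def Vs_def)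
  have UU': "U * Us = 1\<^sub>m n" and VV': "V * Vs = 1\<^sub>m n"
    using mat_mult_left_right_inverse[OF cs(1) c(1) UU] mat_mult_left_right_inverse[OF cs(2) c(2) VV]
    by auto
  have eq: "U * D * Us = V * E * Vs"
    using U V by (auto simp: unitary_diagonalization_def n_def D_def E_def Us_def Vs_def)
  note [simp] = assoc_mult_mat[of _ n n _ n _ n]
  have l1: "Vs * (U * D * Us) * U = W * D"
    using cc UU by (simp add: W_def)
  have l2: "Vs * (V * E * Vs) * U = E * W"
  proof -
    have "Vs * (V * E * Vs) * U = (Vs * V) * (E * (Vs * U))" using cc by simp
    then show ?thesis using cc by (simp only: VV W_def) simp
  qed
  have WD: "W * D = E * W" using l1 l2 eq by simp
  have "W * fD = fE * W"
  proof (rule eq_matI)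
    fix i j assume ij: "i < dim_row (fE * W)" "j < dim_col (fE * W)"
    then have ij: "i < n" "j < n" using cc by auto
    have "(W * D) $$ (i,j) = (E * W) $$ (i,j)" using WD by simp
    then have "W $$ (i,j) * complex_of_real (d j) = complex_of_real (e i) * W $$ (i,j)"
      using ij W by (simp add: D_def E_def mat_diag_mult_right[OF W] mat_diag_mult_left[OF W])
    then have "W $$ (i,j) = 0 \<or> d j = e i" by auto
    then show "(W * fD) $$ (i,j) = (fE * W) $$ (i,j)"
      using ij W by (auto simp: fD_def fE_def mat_diag_mult_right[OF W] mat_diag_mult_left[OF W])
  qed (use cc in auto)
  then have "V * (W * fD) * Us = V * (fE * W) * Us" by simp
  moreover have "V * (W * fD) * Us = U * fD * Us"
  proof -
    have "V * (W * fD) * Us = (V * Vs) * (U * (fD * Us))" using cc by (simp add: W_def)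
    then show ?thesis using cc by (simp only: VV') simp
  qed
  moreover have "V * (fE * W) * Us = V * fE * Vs"
    using cc UU' by (simp add: W_def)
  ultimately show ?thesis by (simp add: n_def fD_def fE_def Us_def Vs_def)
qed

lemma mat_fun_eq:
  assumes "unitary_diagonalization A U d"
  shows "mat_fun f A = U * mat_diag (dim_row A) (\<lambda>i. complex_of_real (f (d i))) * mat_adjoint U"
  unfolding mat_fun_def
  by (rule the_equality) (use assms mat_fun_unique in blast)+

end

(*
  Fix A \<le> B and a vector v. In terms of the eigenvalues, <(h(B) - h(A)) v, v> is a linear functional
  of g, supported on the square roots of the at most 2N eigenvalues of A and B. It is non-negative for
  g(x) = x / (x^2 + l), l \<ge> 0, because t / (t + l) and -1 / (t + l) are operator monotone. Clearing
  denominators in l gives a polynomial p of degree < 2N that is non-negative on the half-line, and a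
  factorization p(-z^2) = U(z) U(-z) with U real, of degree < 2N, rewrites the functional as
  g \<mapsto> sum of u_i u_j (g(x_i) + g(x_j)) / (x_i + x_j), which is non-negative since g is anti-Loewner of
  order 2N.
*)
theory Submission
  imports Defs
begin

section \<open>Polynomials non-negative on the half-line\<close>

text \<open>The functions x / (x^2 + l) have the kernel (v * w + l) / ((v^2 + l) * (w^2 + l)), which
  has rank at most 2 and is positive semidefinite for l >= 0, so they are themselves anti-Loewner of
  every order on the positive half-line. The argument is a duality: on at most 2N positive nodes, a
  functional that is non-negative on these special functions is already one value of the kernel's
  quadratic form, with a test vector independent of g. That a single vector suffices, and not a sum
  of several squares, comes from the single factor U; that the vector is real comes from U being
  real. The degree bound is what allows U to be recovered from its values at the nodes.\<close>

lemma poly_nonneg_cancel_factor: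
  fixes f q :: "real poly"
  assumes prod: "\<And>x. 0 \<le> x \<Longrightarrow> 0 \<le> poly (f * q) x"
    and f: "\<And>x. 0 \<le> x \<Longrightarrow> 0 \<le> poly f x" "f \<noteq> 0"
    and x: "0 \<le> x"
  shows "0 \<le> poly q x"
proof (rule ccontr)
  assume "\<not> 0 \<le> poly q x"
  \<comment> \<open>The right side of x stays inside the half-line even for x = 0. Where q is
    negative f has to vanish, and a non-zero polynomial cannot vanish on an interval.\<close>
  then have "\<forall>\<^sub>F y in at_right x. poly q y < 0"
    by (intro order_tendstoD(2)[of _ "poly q x"] tendsto_intros) auto
  then obtain c where c: "x < c" "\<And>y. x < y \<Longrightarrow> y < c \<Longrightarrow> poly q y < 0"
    by (auto simp: eventually_at_right_field)
  have "poly f y = 0" if "y \<in> {x<..<c}" for y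
  proof -
    have "poly q y < 0" "0 \<le> poly f y" "0 \<le> poly f y * poly q y"
      using that c x f(1)[of y] prod[of y] by auto
    then show ?thesis
      by (metis mult_less_0_iff not_less order_le_less mult.commute)
  qed
  then have "{x<..<c} \<subseteq> {y. poly f y = 0}" by auto
  then have "finite {x<..<c}"
    using poly_roots_finite[OF f(2)] finite_subset by blast
  then show False using infinite_Ioo[OF c(1)] by blast
qed

(* For z = i s the right-hand side is the square of the modulus of U (i s), so this is the spectral
   factorization of the even non-negative polynomial p (s^2). *)
lemma even_reflection_product:
  fixes p :: "real poly"
  assumes "\<And>x. 0 \<le> x \<Longrightarrow> 0 \<le> poly p x"
  shows "\<exists>U. degree U \<le> degree p \<and> (\<forall>z::real. poly p (- z\<^sup>2) = poly U z * poly U (- z))"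
  using assms
proof (induction "degree p" arbitrary: p rule: less_induct)
  case less
  show ?case
  proof (cases "degree p = 0")
    case True
    then obtain c where c: "p = [:c:]" by (metis degree_eq_zeroE)
    then have "0 \<le> c" using less.prems[of 0] by simp
    then show ?thesis using c by (intro exI[of _ "[:sqrt c:]"]) auto
  next
    case False
    \<comment> \<open>A factor f with its own reflection factor V is split off: reflection factors
      multiply, and the quotient stays non-negative on the half-line, so the induction applies to
      it. The cases below supply f and V.\<close>
    have step: ?thesis
      if p: "p = f * q" and f: "f \<noteq> 0" "degree f \<noteq> 0" "\<And>x. 0 \<le> x \<Longrightarrow> 0 \<le> poly f x"
        and V: "degree V \<le> degree f" "\<And>z. poly f (- z\<^sup>2) = poly V z * poly V (- z)" for f q V
    proof -
      have "p \<noteq> 0" using False by auto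
      then have dp: "degree p = degree f + degree q"
        using p by (auto simp: degree_mult_eq)
      have "\<exists>U. degree U \<le> degree q \<and> (\<forall>z. poly q (- z\<^sup>2) = poly U z * poly U (- z))"
      proof (rule less.hyps)
        show "degree q < degree p" using dp f(2) by simp
        show "0 \<le> poly q x" if "0 \<le> x" for x
          using poly_nonneg_cancel_factor[of f q x] less.prems p f that by auto
      qed
      then obtain U where U: "degree U \<le> degree q" "\<And>z. poly q (- z\<^sup>2) = poly U z * poly U (- z)"
        by auto
      show ?thesis
        using U V dp degree_mult_le[of V U] by (intro exI[of _ "V * U"]) (auto simp: p)
    qed
    let ?P = "map_poly complex_of_real p"
    have "degree ?P = degree p" by (simp add: degree_map_poly)
    then have "\<not> constant (poly ?P)" using False by (simp add: constant_degree)
    then obtain w where w: "poly ?P w = 0" using fundamental_theorem_of_algebra by blast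
    consider (neg) "Im w = 0" "Re w \<le> 0" | (pos) "Im w = 0" "0 < Re w" | (nonreal) "Im w \<noteq> 0"
      by fastforce
    then show ?thesis
    proof cases
      case neg
      then have "w = complex_of_real (Re w)" by (simp add: complex_eq_iff)
      then have "poly p (Re w) = 0" using w
        by (metis of_real_eq_0_iff of_real_hom.poly_map_poly)
      then obtain q where "p = [:- Re w, 1:] * q"
        by (metis dvdE poly_eq_0_iff_dvd)
      \<comment> \<open>With r = - Re w >= 0 the linear factor at - z^2 is r - z^2 = (sqrt r + z) *
        (sqrt r - z).\<close>
      then show ?thesis
        using neg
        by (intro step[of "[:- Re w, 1:]" q "[:sqrt (- Re w), 1:]"])
          (auto simp: algebra_simps power2_eq_square)
    next
      case pos
      then have "w = complex_of_real (Re w)" by (simp add: complex_eq_iff)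
      then have root: "poly p (Re w) = 0" using w
        by (metis of_real_eq_0_iff of_real_hom.poly_map_poly)
      then obtain r where r: "p = [:- Re w, 1:] * r"
        by (metis dvdE poly_eq_0_iff_dvd)
      (* p has a minimum at this root, so the root is double *)
      have "poly (pderiv p) (Re w) = 0"
      proof (rule DERIV_local_min[OF poly_DERIV])
        show "0 < Re w" by fact
        show "\<forall>y. \<bar>Re w - y\<bar> < Re w \<longrightarrow> poly p (Re w) \<le> poly p y"
          using less.prems root by auto
      qed
      then have "poly r (Re w) = 0" by (simp add: r pderiv_mult pderiv_pCons del: mult_pCons_left)
      then obtain q where q: "r = [:- Re w, 1:] * q"
        by (metis dvdE poly_eq_0_iff_dvd)
      \<comment> \<open>At - z^2 the squared factor becomes (z^2 + Re w)^2, and z^2 + Re w is even,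
        so it serves both as V z and as V (- z).\<close>
      have "p = [:- Re w, 1:]\<^sup>2 * q" by (simp only: r q power2_eq_square mult.assoc)
      then show ?thesis
      proof (rule step)
        show "degree [:Re w, 0, 1:] \<le> degree ([:- Re w, 1:]\<^sup>2)" "degree ([:- Re w, 1:]\<^sup>2) \<noteq> 0"
          by (simp_all add: degree_power_eq)
        show "poly ([:- Re w, 1:]\<^sup>2) (- z\<^sup>2) = poly [:Re w, 0, 1:] z * poly [:Re w, 0, 1:] (- z)" for z
          by (simp add: power2_eq_square algebra_simps)
      qed (simp_all add: poly_power)
    next
      case nonreal
      \<comment> \<open>f is (x - w) * (x - cnj w). Completing the square, f (- z^2) = (z^2 + |w|)^2
        - \<beta>^2 * z^2, a difference of squares; Re w <= |w| makes \<beta> real.\<close>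
      define f where "f = [:(Re w)\<^sup>2 + (Im w)\<^sup>2, - 2 * Re w, 1:]"
      define \<beta> where "\<beta> = sqrt (2 * cmod w - 2 * Re w)"
      have \<beta>: "\<beta>\<^sup>2 = 2 * cmod w - 2 * Re w"
        unfolding \<beta>_def using complex_Re_le_cmod[of w] by simp
      have deg: "degree f = 2" by (simp add: f_def)
      then have "f \<noteq> 0" by auto
      have fw: "poly (map_poly complex_of_real f) w = 0"
        by (simp add: f_def map_poly_pCons complex_eq_iff power2_eq_square algebra_simps)
      \<comment> \<open>The remainder is c0 + c1 * x with real coefficients and vanishes at the
        non-real w, which forces c1 = 0 and then c0 = 0.\<close>
      have "p mod f = 0"
      proof -
        interpret hom: map_poly_comm_ring_hom complex_of_real ..
        have "degree (p mod f) < 2" using degree_mod_less[OF \<open>f \<noteq> 0\<close>, of p] deg by auto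
        then obtain c0 c1 where c: "p mod f = [:c0, c1:]"
          by (metis One_nat_def degree_pCons_0 less_2_cases pCons_cases degree_eq_zeroE
              degree_pCons_eq_if nat.inject pCons_0_0)
        have "p = f * (p div f) + [:c0, c1:]" using c by (metis mult_div_mod_eq)
        then have "poly ?P w = poly (map_poly complex_of_real (f * (p div f) + [:c0, c1:])) w"
          by simp
        also have "\<dots> = c0 + w * c1"
          by (simp only: hom.hom_add hom.hom_mult poly_add poly_mult fw)
            (simp add: of_real_hom.map_poly_pCons_hom)
        finally show ?thesis using w nonreal c by (auto simp: complex_eq_iff)
      qed
      then have "p = f * (p div f)" by auto
      then show ?thesis
      proof (rule step)
        show "degree [:cmod w, \<beta>, 1:] \<le> degree f" using deg by simp
        show "degree f \<noteq> 0" "f \<noteq> 0" using deg by auto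
        show "0 \<le> poly f x" for x
        proof -
          have "poly f x = (x - Re w)\<^sup>2 + (Im w)\<^sup>2"
            by (simp add: f_def power2_eq_square algebra_simps)
          then show ?thesis by simp
        qed
        show "poly f (- z\<^sup>2) = poly [:cmod w, \<beta>, 1:] z * poly [:cmod w, \<beta>, 1:] (- z)" for z
        proof -
          have "poly [:cmod w, \<beta>, 1:] z * poly [:cmod w, \<beta>, 1:] (- z) =
            z ^ 4 + 2 * cmod w * z\<^sup>2 - \<beta>\<^sup>2 * z\<^sup>2 + (cmod w)\<^sup>2"
            by (simp add: power2_eq_square power4_eq_xxxx algebra_simps)
          also have "\<dots> = poly f (- z\<^sup>2)"
            unfolding \<beta> cmod_power2
            by (simp add: f_def power2_eq_square power4_eq_xxxx algebra_simps)
          finally show ?thesis by simp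
        qed
      qed
    qed
  qed
qed

text \<open>Interpolating at the points - v turns the factors of the basis polynomials into sums w +
  x. Relative to the product over all of S, each basis polynomial is then 1 / (v + x), the
  denominator of the anti-Loewner kernel.\<close>

lemma lagrange_at_negated_nodes:
  fixes U :: "'a::field poly"
  assumes S: "finite S" and deg: "degree U < card S"
  shows "poly U x = (\<Sum>v\<in>S. poly U (- v) / (\<Prod>w\<in>S - {v}. w - v) * (\<Prod>w\<in>S - {v}. w + x))"
proof -
  define c where "c v = poly U (- v) / (\<Prod>w\<in>S - {v}. w - v)" for v
  define L where "L = (\<Sum>v\<in>S. Polynomial.smult (c v) (\<Prod>w\<in>S - {v}. [:w, 1:]))"
  have "U = L"
  proof (rule poly_eqI_degree[of "uminus ` S"])
    have card: "card (uminus ` S) = card S" by (simp add: card_image)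
    show "card (uminus ` S) > degree U" using deg card by simp
    have "degree L < card S" unfolding L_def
    proof (rule degree_sum_less)
      fix v assume v: "v \<in> S"
      have "degree (\<Prod>w\<in>S - {v}. [:w, 1:]) \<le> (\<Sum>w\<in>S - {v}. degree [:w, 1:])"
        using S by (intro degree_prod_sum_le[unfolded o_def]) auto
      also have "\<dots> < card S" using card_Diff1_less[OF S v] by simp
      finally show "degree (Polynomial.smult (c v) (\<Prod>w\<in>S - {v}. [:w, 1:])) < card S"
        using degree_smult_le le_less_trans by blast
    qed (use deg in auto)
    then show "card (uminus ` S) > degree L" using card by simp
    fix y assume "y \<in> uminus ` S"
    then obtain v where v: "v \<in> S" "y = - v" by auto
    have "poly L y = (\<Sum>u\<in>S. c u * (\<Prod>w\<in>S - {u}. w + y))"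
      by (simp add: L_def poly_sum poly_prod)
    also have "\<dots> = c v * (\<Prod>w\<in>S - {v}. w - v)"
      using v S by (subst sum.remove[of _ v]) (auto intro!: sum.neutral prod_zero)
    also have "\<dots> = poly U y"
      using S v by (auto simp: c_def prod_zero_iff)
    finally show "poly U y = poly L y" by simp
  qed
  then have "poly U x = poly L x" by simp
  then show ?thesis by (simp add: L_def poly_sum poly_prod c_def)
qed

section \<open>Linear functionals of an anti-Loewner function\<close>

text \<open>The coefficient of g w in the quadratic form with vector u is 2 * u w * (sum over v of u
  v / (v + w)). Matching it with \<alpha> w for every node gives a quadratic system for u, and
  \<open>test\<close> is what makes it solvable over the reals.\<close>

lemma sum_kernel_nonneg_of_test_functions:
  fixes \<alpha> g :: "real \<Rightarrow> real"
  assumes S: "finite S" "\<And>z. z \<in> S \<Longrightarrow> 0 < z"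
    and test: "\<And>l. 0 \<le> l \<Longrightarrow> 0 \<le> (\<Sum>z\<in>S. \<alpha> z * (z / (z\<^sup>2 + l)))"
    and kernel: "\<And>u. 0 \<le> (\<Sum>v\<in>S. \<Sum>w\<in>S. u v * u w * ((g v + g w) / (v + w)))"
  shows "0 \<le> (\<Sum>z\<in>S. \<alpha> z * g z)"
proof (cases "S = {}")
  case False
  define p where "p = (\<Sum>z\<in>S. Polynomial.smult (\<alpha> z * z) (\<Prod>w\<in>S - {z}. [:w\<^sup>2, 1:]))"
  have p: "poly p l = (\<Sum>z\<in>S. \<alpha> z * z * (\<Prod>w\<in>S - {z}. w\<^sup>2 + l))" for l
    by (simp add: p_def poly_sum poly_prod)
  have p_nonneg: "0 \<le> poly p l" if "0 \<le> l" for l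
  proof -
    have pos: "0 < z\<^sup>2 + l" if "z \<in> S" for z using S(2)[OF that] \<open>0 \<le> l\<close> by (simp add: add_pos_nonneg)
    have "poly p l = (\<Sum>z\<in>S. \<alpha> z * (z / (z\<^sup>2 + l)) * (\<Prod>w\<in>S. w\<^sup>2 + l))"
      unfolding p
    proof (rule sum.cong[OF refl])
      fix z assume z: "z \<in> S"
      show "\<alpha> z * z * (\<Prod>w\<in>S - {z}. w\<^sup>2 + l) = \<alpha> z * (z / (z\<^sup>2 + l)) * (\<Prod>w\<in>S. w\<^sup>2 + l)"
        using pos[OF z] S(1) z by (simp add: prod.remove)
    qed
    also have "\<dots> = (\<Sum>z\<in>S. \<alpha> z * (z / (z\<^sup>2 + l))) * (\<Prod>w\<in>S. w\<^sup>2 + l)"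
      by (simp add: sum_distrib_right)
    also have "\<dots> \<ge> 0"
      using test[OF that] pos by (intro mult_nonneg_nonneg prod_nonneg) (auto intro: less_imp_le)
    finally show ?thesis .
  qed
  have "degree p < card S" unfolding p_def
  proof (rule degree_sum_less)
    fix z assume z: "z \<in> S"
    have "degree (\<Prod>w\<in>S - {z}. [:w\<^sup>2, 1:]) \<le> (\<Sum>w\<in>S - {z}. degree [:w\<^sup>2, 1:])"
      using S by (intro degree_prod_sum_le[unfolded o_def]) auto
    also have "\<dots> < card S" using card_Diff1_less[OF S(1) z] by simp
    finally show "degree (Polynomial.smult (\<alpha> z * z) (\<Prod>w\<in>S - {z}. [:w\<^sup>2, 1:])) < card S"
      using degree_smult_le le_less_trans by blast
  qed (use S False in \<open>auto simp: card_gt_0_iff\<close>)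
  then obtain U where U: "degree U < card S" "\<And>z. poly p (- z\<^sup>2) = poly U z * poly U (- z)"
    using even_reflection_product[OF p_nonneg] by (metis le_less_trans)
  define u where "u v = poly U (- v) / (\<Prod>w\<in>S - {v}. w - v)" for v
  (* p (- w^2) = U w * U (- w) at the nodes w, with U written in the Lagrange basis at the points - v *)
  have \<alpha>: "\<alpha> w = 2 * u w * (\<Sum>v\<in>S. u v / (v + w))" if w: "w \<in> S" for w
  proof -
    define D E where "D = (\<Prod>v\<in>S - {w}. v - w)" and "E = (\<Prod>v\<in>S - {w}. v + w)"
    have D: "D \<noteq> 0" using S(1) by (auto simp: D_def)
    have E: "E \<noteq> 0" using S w by (auto simp: E_def) (metis add_pos_pos less_irrefl)
    \<comment> \<open>For z different from w the product contains the factor w^2 - w^2, so only the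
      summand z = w survives and \<alpha> w can be read off.\<close>
    have "poly p (- w\<^sup>2) = \<alpha> w * w * (\<Prod>v\<in>S - {w}. v\<^sup>2 - w\<^sup>2)"
      unfolding p using w S(1) by (subst sum.remove[of _ w]) (auto intro!: sum.neutral prod_zero)
    also have "(\<Prod>v\<in>S - {w}. v\<^sup>2 - w\<^sup>2) = D * E"
      unfolding D_def E_def prod.distrib[symmetric]
      by (intro prod.cong) (simp_all add: power2_eq_square algebra_simps)
    finally have 1: "poly p (- w\<^sup>2) = \<alpha> w * w * (D * E)" .
    have 2: "poly U (- w) = u w * D" using D by (simp add: u_def D_def)
    have "poly U w = (\<Sum>v\<in>S. u v * (\<Prod>v'\<in>S - {v}. v' + w))"
      unfolding u_def by (rule lagrange_at_negated_nodes[OF S(1) U(1)])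
    also have "\<dots> = (\<Sum>v\<in>S. u v / (v + w) * (\<Prod>v'\<in>S. v' + w))"
    proof (rule sum.cong[OF refl])
      fix v assume v: "v \<in> S"
      then have "v + w \<noteq> 0" using S(2)[of v] S(2)[of w] w by auto
      then show "u v * (\<Prod>v'\<in>S - {v}. v' + w) = u v / (v + w) * (\<Prod>v'\<in>S. v' + w)"
        using S(1) v by (simp add: prod.remove)
    qed
    \<comment> \<open>The node w itself contributes w + w. Its w cancels against the one in
      \<open>\<alpha> w * w\<close>, and the 2 stays.\<close>
    also have "(\<Prod>v'\<in>S. v' + w) = 2 * w * E"
      using S(1) w by (simp add: prod.remove[of _ w] E_def)
    finally have 3: "poly U w = (\<Sum>v\<in>S. u v / (v + w)) * (2 * w * E)"
      by (simp add: sum_distrib_right)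
    have "\<alpha> w * (w * D * E) = 2 * u w * (\<Sum>v\<in>S. u v / (v + w)) * (w * D * E)"
      using U(2)[of w] unfolding 1 2 3 by (simp add: algebra_simps)
    then show ?thesis using D E S(2)[OF w] by simp
  qed
  \<comment> \<open>Q is half of the quadratic form: the weight u v * u w / (v + w) is symmetric, so
    g w may be replaced by g v under the double sum.\<close>
  define Q where "Q = (\<Sum>v\<in>S. \<Sum>w\<in>S. u v * u w * (g w / (v + w)))"
  have Q': "Q = (\<Sum>v\<in>S. \<Sum>w\<in>S. u v * u w * (g v / (v + w)))"
    unfolding Q_def by (subst sum.swap) (simp add: mult.commute add.commute)
  have "(\<Sum>z\<in>S. \<alpha> z * g z) = (\<Sum>w\<in>S. \<Sum>v\<in>S. 2 * (u v * u w * (g w / (v + w))))"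
    by (rule sum.cong) (simp_all add: \<alpha> sum_distrib_left sum_distrib_right mult_ac)
  also have "\<dots> = 2 * Q"
    unfolding Q_def by (subst sum.swap) (simp add: sum_distrib_left)
  also have "\<dots> = (\<Sum>v\<in>S. \<Sum>w\<in>S. u v * u w * ((g v + g w) / (v + w)))"
    unfolding mult_2 by (subst (1) Q') (simp add: Q_def sum.distrib add_divide_distrib distrib_left)
  finally show ?thesis using kernel[of u] by simp
qed simp

text \<open>\<open>anti_loewner\<close> speaks of exactly n distinct points. A smaller S is padded
  with further points of the infinite set I, and these get weight 0 in the test vector.\<close>

lemma anti_loewner_kernel_nonneg:
  assumes g: "anti_loewner n I g" and I: "infinite I"
    and S: "finite S" "S \<subseteq> I" "card S \<le> n"
  shows "0 \<le> (\<Sum>v\<in>S. \<Sum>w\<in>S. u v * u w * ((g v + g w) / (v + w)))"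
proof -
  obtain T where T: "T \<subseteq> I - S" "finite T" "card T = n - card S"
    using infinite_arbitrarily_large[of "I - S" "n - card S"] I S(1) by auto
  have "card (S \<union> T) = n" using T S by (subst card_Un_disjoint) auto
  then obtain x where x: "bij_betw x {..<n} (S \<union> T)"
    using ex_bij_betw_nat_finite[of "S \<union> T"] S(1) T(2) by (auto simp: lessThan_atLeast0)
  then have inj: "inj_on x {..<n}" and im: "x ` {..<n} = S \<union> T" by (auto simp: bij_betw_def)
  define K where "K = anti_loewner_mat g n x"
  have psd: "psd_mat K"
    using g inj im T S unfolding anti_loewner_def K_def by blast
  define c where "c = Matrix.vec n (\<lambda>i. if x i \<in> S then u (x i) else 0)"
  define e where "e v = (if v \<in> S then u v else 0)" for v
  have K: "K \<in> carrier_mat n n" by (simp add: K_def anti_loewner_mat_def)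
  have "0 \<le> (K *\<^sub>v c) \<bullet>c c"
    using psd K by (auto simp: psd_mat_def c_def)
  also have "\<dots> = (\<Sum>i<n. \<Sum>j<n. e (x i) * e (x j) * ((g (x i) + g (x j)) / (x i + x j)))"
    using K by (auto simp: scalar_prod_def c_def K_def anti_loewner_mat_def e_def sum_distrib_left
        sum_distrib_right lessThan_atLeast0 mult_ac intro!: sum.cong)
  also have "\<dots> = (\<Sum>v\<in>S \<union> T. \<Sum>w\<in>S \<union> T. e v * e w * ((g v + g w) / (v + w)))"
    using inj by (simp add: im[symmetric] sum.reindex)
  also have "\<dots> = (\<Sum>v\<in>S. \<Sum>w\<in>S. e v * e w * ((g v + g w) / (v + w)))"
    using S(1) T(2) by (intro sum.mono_neutral_cong_right ballI) (auto simp: e_def intro!: sum.mono_neutral_right)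
  also have "\<dots> = (\<Sum>v\<in>S. \<Sum>w\<in>S. u v * u w * ((g v + g w) / (v + w)))"
    by (simp add: e_def)
  finally show ?thesis .
qed

text \<open>Nodes may coincide here, as multiple eigenvalues or eigenvalues common to A and B do;
  coefficients at equal nodes are added up, which only lowers the number of nodes.\<close>

lemma anti_loewner_sum_nonneg:
  fixes c x :: "'a \<Rightarrow> real"
  assumes g: "anti_loewner n I g" and I: "infinite I" "\<And>z. z \<in> I \<Longrightarrow> 0 < z"
    and J: "finite J" "card J \<le> n" "x ` J \<subseteq> I"
    and test: "\<And>l. 0 \<le> l \<Longrightarrow> 0 \<le> (\<Sum>k\<in>J. c k * (x k / ((x k)\<^sup>2 + l)))"
  shows "0 \<le> (\<Sum>k\<in>J. c k * g (x k))"
proof -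
  define \<alpha> where "\<alpha> z = (\<Sum>k\<in>{k\<in>J. x k = z}. c k)" for z
  have group: "(\<Sum>k\<in>J. c k * f (x k)) = (\<Sum>z\<in>x ` J. \<alpha> z * f z)" for f
    by (subst sum.image_gen[OF J(1), of _ x]) (simp add: \<alpha>_def sum_distrib_right)
  show ?thesis unfolding group
  proof (rule sum_kernel_nonneg_of_test_functions)
    show "0 \<le> (\<Sum>v\<in>x ` J. \<Sum>w\<in>x ` J. u v * u w * ((g v + g w) / (v + w)))" for u
      by (rule anti_loewner_kernel_nonneg[OF g I(1)])
        (use J card_image_le[OF J(1), of x] in auto)
    show "0 \<le> (\<Sum>z\<in>x ` J. \<alpha> z * (z / (z\<^sup>2 + l)))" if "0 \<le> l" for l
      using test[OF that] group[of "\<lambda>z. z / (z\<^sup>2 + l)"] by simp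
  qed (use J I in auto)
qed

section \<open>Spectral theorem for Hermitian matrices\<close>

lemma mat_adjoint_dim[simp]: "dim_row (mat_adjoint A) = dim_col A" "dim_col (mat_adjoint A) = dim_row A"
  by (simp_all add: mat_adjoint_def)

lemma mat_adjoint_index[simp]:
  "i < dim_col A \<Longrightarrow> j < dim_row A \<Longrightarrow> mat_adjoint A $$ (i, j) = conjugate (A $$ (j, i))"
  by (simp add: mat_adjoint_def mat_of_rows_index)

lemma mat_adjoint_mat_adjoint[simp]: "mat_adjoint (mat_adjoint A) = A"
  by (rule eq_matI) auto

lemma mat_adjoint_mult:
  fixes A B :: "'a::conjugatable_field mat"
  assumes "A \<in> carrier_mat n m" "B \<in> carrier_mat m k"
  shows "mat_adjoint (A * B) = mat_adjoint B * mat_adjoint A"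
  by (rule eq_matI)
    (use assms in \<open>auto simp: scalar_prod_def sum_conjugate conjugate_dist_mul mult.commute intro!: sum.cong\<close>)

lemma mat_adjoint_four_block:
  assumes "A \<in> carrier_mat n1 m1" "B \<in> carrier_mat n1 m2" "C \<in> carrier_mat n2 m1" "D \<in> carrier_mat n2 m2"
  shows "mat_adjoint (four_block_mat A B C D) =
    four_block_mat (mat_adjoint A) (mat_adjoint C) (mat_adjoint B) (mat_adjoint D)"
  by (rule eq_matI) (use assms in auto)

lemma block_diag_mult:
  fixes A1 A2 B1 B2 :: "'a::semiring_0 mat"
  assumes "A1 \<in> carrier_mat k k" "A2 \<in> carrier_mat k k" "B1 \<in> carrier_mat n n" "B2 \<in> carrier_mat n n"
  shows "four_block_mat A1 (0\<^sub>m k n) (0\<^sub>m n k) B1 * four_block_mat A2 (0\<^sub>m k n) (0\<^sub>m n k) B2 =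
    four_block_mat (A1 * A2) (0\<^sub>m k n) (0\<^sub>m n k) (B1 * B2)"
  by (subst mult_four_block_mat[of _ k k _ n _ n _ _ k _ n]) (use assms in auto)

text \<open>Gram-Schmidt on a basis that starts with v leaves v in place and makes the rest
  orthogonal to it; dividing each vector by its norm makes the columns orthonormal.\<close>

lemma unitary_with_first_col:
  fixes v :: "complex vec"
  assumes v: "v \<in> carrier_vec n" "v \<noteq> 0\<^sub>v n" and n: "n \<noteq> 0"
  shows "\<exists>W c. W \<in> carrier_mat n n \<and> mat_adjoint W * W = 1\<^sub>m n \<and> col W 0 = c \<cdot>\<^sub>v v"
proof -
  interpret cof_vec_space n "TYPE(complex)" .
  define b where "b = basis_completion v"
  note basis = basis_completion[OF v, folded b_def]
  obtain vs where bv: "b = v # vs" using basis(6,7) n by (cases b) auto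
  define ws where "ws = gram_schmidt n b"
  note gs = gram_schmidt_result[OF basis(2,4,5) ws_def]
  have len: "length ws = n" using gs(4) basis(6) by simp
  have "hd ws = v" using gram_schmidt_hd[OF v(1), of vs] by (simp add: ws_def bv)
  then have hd: "ws ! 0 = v" using len n by (cases ws) auto
  have ws: "ws ! i \<in> carrier_vec n" if "i < n" for i using gs(3) len that by auto
  \<comment> \<open>The norm of the i-th vector. Its square is a complex number that is real and
    non-negative, hence the passage through \<open>Re\<close>.\<close>
  define r where "r i = complex_of_real (sqrt (Re (ws ! i \<bullet>c ws ! i)))" for i
  have r: "r i * r i = ws ! i \<bullet>c ws ! i" if "i < n" for i
  proof -
    have "0 \<le> ws ! i \<bullet>c ws ! i" by (rule conjugate_square_ge_0_vec)
    then show ?thesis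
      by (simp add: r_def complex_eq_iff less_eq_complex_def flip: of_real_mult)
  qed
  define W where "W = Matrix.mat n n (\<lambda>(i, j). ws ! j $ i / r j)"
  have "mat_adjoint W * W = 1\<^sub>m n"
  proof (rule eq_matI)
    fix i j assume "i < dim_row (1\<^sub>m n :: complex mat)" "j < dim_col (1\<^sub>m n :: complex mat)"
    then have ij: "i < n" "j < n" by auto
    have "(mat_adjoint W * W) $$ (i, j) = (ws ! j \<bullet>c ws ! i) / (r i * r j)"
      using ij ws[OF ij(1)] ws[OF ij(2)]
      by (auto simp: W_def scalar_prod_def r_def sum_divide_distrib mult_ac intro!: sum.cong)
    also have "\<dots> = (1\<^sub>m n) $$ (i, j)"
      using corthogonalD[OF gs(2), of j i] ij len r[OF ij(1)] by auto
    finally show "(mat_adjoint W * W) $$ (i, j) = (1\<^sub>m n) $$ (i, j)" .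
  qed (auto simp: W_def)
  moreover have "col W 0 = (1 / r 0) \<cdot>\<^sub>v v"
    using n v(1) hd by (intro eq_vecI) (auto simp: W_def)
  ultimately show ?thesis by (metis W_def mat_carrier)
qed

lemma unitary_adjoint_right:
  fixes U :: "complex mat"
  assumes "U \<in> carrier_mat n n" "mat_adjoint U * U = 1\<^sub>m n"
  shows "U * mat_adjoint U = 1\<^sub>m n"
  using mat_mult_left_right_inverse[OF mat_adjoint_carrier[OF assms(1)] assms] .

text \<open>Deflation: in an orthonormal basis that starts with an eigenvector, the first column is
  zero below the diagonal, hermiticity clears the first row as well, and a Hermitian block of size n
  remains.\<close>

lemma hermitian_unitary_diagonalization:
  assumes "A \<in> carrier_mat n n" "hermitian_mat A"
  shows "\<exists>U d. unitary_diagonalization A U d"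
  using assms
proof (induction n arbitrary: A)
  case 0
  then have "unitary_diagonalization A (1\<^sub>m 0) (\<lambda>_. 0)"
    unfolding unitary_diagonalization_def unitary_mat_def by (auto intro!: eq_matI)
  then show ?case by blast
next
  case (Suc n)
  note A = Suc.prems(1)
  have Aadj: "mat_adjoint A = A" using Suc.prems(2) by (simp add: hermitian_mat_def)
  obtain e where "eigenvalue A e"
    using spectrum_non_empty[OF A] by (auto simp: spectrum_def)
  then obtain v where "eigenvector A v e" by (auto simp: eigenvalue_def)
  then have v: "v \<in> carrier_vec (Suc n)" "v \<noteq> 0\<^sub>v (Suc n)" "A *\<^sub>v v = e \<cdot>\<^sub>v v"
    using A by (auto simp: eigenvector_def)
  obtain W c where W: "W \<in> carrier_mat (Suc n) (Suc n)" "mat_adjoint W * W = 1\<^sub>m (Suc n)"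
    and col: "col W 0 = c \<cdot>\<^sub>v v"
    using unitary_with_first_col[OF v(1,2)] by auto
  define Ws where "Ws = mat_adjoint W"
  have Ws: "Ws \<in> carrier_mat (Suc n) (Suc n)" unfolding Ws_def by (rule mat_adjoint_carrier[OF W(1)])
  have WWs: "W * Ws = 1\<^sub>m (Suc n)" unfolding Ws_def by (rule unitary_adjoint_right[OF W])
  define A' where "A' = Ws * (A * W)"
  have A': "A' \<in> carrier_mat (Suc n) (Suc n)" using A W Ws by (simp add: A'_def)
  have A'adj: "mat_adjoint A' = A'"
  proof -
    have "mat_adjoint A' = mat_adjoint (A * W) * mat_adjoint Ws"
      unfolding A'_def using A W Ws by (intro mat_adjoint_mult) auto
    also have "\<dots> = Ws * A * W"
      using mat_adjoint_mult[OF A W(1)] by (simp add: Ws_def Aadj)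
    also have "\<dots> = A'" using assoc_mult_mat[OF Ws A W(1)] by (simp add: A'_def)
    finally show ?thesis .
  qed
  have colA': "col A' 0 = e \<cdot>\<^sub>v unit_vec (Suc n) 0"
  proof -
    have cW: "col W 0 \<in> carrier_vec (Suc n)" using W(1) by (metis carrier_matD(1) col_dim)
    have "A *\<^sub>v col W 0 = e \<cdot>\<^sub>v col W 0"
      unfolding col using mult_mat_vec[OF A v(1)] v(3) by (simp add: smult_smult_assoc mult.commute)
    then have "col A' 0 = Ws *\<^sub>v (e \<cdot>\<^sub>v col W 0)"
      unfolding A'_def using col_mult2[OF Ws mult_carrier_mat[OF A W(1)], of 0] col_mult2[OF A W(1), of 0]
      by (simp only: zero_less_Suc)
    also have "\<dots> = e \<cdot>\<^sub>v col (Ws * W) 0"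
      unfolding mult_mat_vec[OF Ws cW] using col_mult2[OF Ws W(1), of 0] by (simp only: zero_less_Suc)
    finally show ?thesis using W(2) by (simp add: Ws_def)
  qed
  have A'0: "A' $$ (i, 0) = (if i = 0 then e else 0)" if "i < Suc n" for i
    using arg_cong[OF colA', of "\<lambda>u. u $ i"] that A' by simp
  have sym: "A' $$ (i, j) = cnj (A' $$ (j, i))" if "i < Suc n" "j < Suc n" for i j
    using arg_cong[OF A'adj, of "\<lambda>M. M $$ (i, j)"] that A' by simp
  \<comment> \<open>A diagonal entry of a Hermitian matrix is real, so e can head the real
    eigenvalue list d'.\<close>
  have e: "complex_of_real (Re e) = e"
    using sym[of 0 0] A'0[of 0] by (simp add: complex_eq_iff)
  define B where "B = Matrix.mat n n (\<lambda>(i, j). A' $$ (Suc i, Suc j))"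
  have B: "B \<in> carrier_mat n n" by (simp add: B_def)
  have A'block: "A' = four_block_mat (Matrix.mat 1 1 (\<lambda>_. e)) (0\<^sub>m 1 n) (0\<^sub>m n 1) B"
  proof (rule eq_matI)
    fix i j
    assume "i < dim_row (four_block_mat (Matrix.mat 1 1 (\<lambda>_. e)) (0\<^sub>m 1 n) (0\<^sub>m n 1) B)"
      "j < dim_col (four_block_mat (Matrix.mat 1 1 (\<lambda>_. e)) (0\<^sub>m 1 n) (0\<^sub>m n 1) B)"
    then have "i < Suc n" "j < Suc n" by (auto simp: B_def)
    then show "A' $$ (i, j) = four_block_mat (Matrix.mat 1 1 (\<lambda>_. e)) (0\<^sub>m 1 n) (0\<^sub>m n 1) B $$ (i, j)"
      using A'0[of i] A'0[of j] sym[of i j] by (cases i; cases j) (auto simp: B_def)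
  qed (use A' in \<open>auto simp: B_def\<close>)
  have "hermitian_mat B"
    unfolding hermitian_mat_def
    by (auto intro!: eq_matI simp: B_def sym[symmetric])
  then obtain V d where Vd: "unitary_diagonalization B V d" using Suc.IH[OF B] by blast
  then have V: "V \<in> carrier_mat n n" "mat_adjoint V * V = 1\<^sub>m n"
    and BV: "B = V * mat_diag n (\<lambda>i. complex_of_real (d i)) * mat_adjoint V"
    using B by (auto simp: unitary_diagonalization_def unitary_mat_def)
  have V': "mat_adjoint V \<in> carrier_mat n n" by (rule mat_adjoint_carrier[OF V(1)])
  define d' where "d' = case_nat (Re e) d"
  define V1 where "V1 = four_block_mat (1\<^sub>m 1) (0\<^sub>m 1 n) (0\<^sub>m n 1) V"
  define D where "D = mat_diag (Suc n) (\<lambda>i. complex_of_real (d' i))"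
  have V1: "V1 \<in> carrier_mat (Suc n) (Suc n)"
    using four_block_carrier_mat[OF one_carrier_mat[of 1] V(1)] by (simp add: V1_def)
  have D: "D \<in> carrier_mat (Suc n) (Suc n)" by (simp add: D_def)
  have V1adj: "mat_adjoint V1 = four_block_mat (1\<^sub>m 1) (0\<^sub>m 1 n) (0\<^sub>m n 1) (mat_adjoint V)"
  proof -
    have "mat_adjoint (1\<^sub>m 1 :: complex mat) = 1\<^sub>m 1" "mat_adjoint (0\<^sub>m 1 n :: complex mat) = 0\<^sub>m n 1"
      "mat_adjoint (0\<^sub>m n 1 :: complex mat) = 0\<^sub>m 1 n"
      by (auto intro!: eq_matI)
    then show ?thesis
      unfolding V1_def by (subst mat_adjoint_four_block[of _ 1 1 _ n _ n]) (use V in auto)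
  qed
  define V1s where "V1s = mat_adjoint V1"
  have V1s: "V1s \<in> carrier_mat (Suc n) (Suc n)" unfolding V1s_def by (rule mat_adjoint_carrier[OF V1])
  have V1V1: "V1s * V1 = 1\<^sub>m (Suc n)"
    unfolding V1s_def V1adj unfolding V1_def
    using V V' by (simp add: block_diag_mult[where k = "Suc 0" and n = n])
  have "D = four_block_mat (Matrix.mat 1 1 (\<lambda>_. e)) (0\<^sub>m 1 n) (0\<^sub>m n 1) (mat_diag n (\<lambda>i. complex_of_real (d i)))"
    unfolding D_def
    by (rule eq_matI) (auto simp: mat_diag_def d'_def e split: nat.split)
  then have A'D: "A' = V1 * D * V1s"
    unfolding V1s_def V1adj A'block unfolding V1_def
    using V V' by (simp add: block_diag_mult[where k = "Suc 0" and n = n] BV)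
  note [simp] = assoc_mult_mat[of _ "Suc n" "Suc n" _ "Suc n" _ "Suc n"]
  define U where "U = W * V1"
  have U: "U \<in> carrier_mat (Suc n) (Suc n)" using W V1 by (simp add: U_def)
  have Us: "mat_adjoint U = V1s * Ws"
    unfolding U_def V1s_def Ws_def by (rule mat_adjoint_mult[OF W(1) V1])
  have WsW: "Ws * (W * M) = M" if "M \<in> carrier_mat (Suc n) (Suc n)" for M
    using W Ws that by (subst assoc_mult_mat[symmetric, of _ "Suc n" "Suc n" _ "Suc n" _ "Suc n"])
      (auto simp: Ws_def simp del: assoc_mult_mat)
  have WWs': "W * (Ws * M) = M" if "M \<in> carrier_mat (Suc n) (Suc n)" for M
    using W Ws that WWs by (subst assoc_mult_mat[symmetric, of _ "Suc n" "Suc n" _ "Suc n" _ "Suc n"])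
      (auto simp del: assoc_mult_mat)
  have "mat_adjoint U * U = 1\<^sub>m (Suc n)"
    unfolding Us unfolding U_def using W Ws V1 V1s by (simp add: WsW V1V1)
  moreover have "A = U * D * mat_adjoint U"
  proof -
    have "A = W * A' * Ws"
      unfolding A'_def using W Ws A WWs by (simp add: WWs')
    also have "\<dots> = U * D * mat_adjoint U"
      unfolding A'D Us unfolding U_def using W Ws V1 V1s D by simp
    finally show ?thesis .
  qed
  ultimately have "unitary_diagonalization A U d'"
    using U A by (auto simp: unitary_diagonalization_def unitary_mat_def D_def)
  then show ?case by blast
qed

section \<open>Quadratic forms in eigenvector coordinates\<close>

lemma mat_adjoint_sprod:
  fixes A :: "complex mat"
  assumes "A \<in> carrier_mat n m" "x \<in> carrier_vec m" "w \<in> carrier_vec n"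
  shows "(A *\<^sub>v x) \<bullet>c w = x \<bullet>c (mat_adjoint A *\<^sub>v w)"
proof -
  have "(A *\<^sub>v x) \<bullet>c w = (\<Sum>i<n. \<Sum>j<m. A $$ (i, j) * x $ j * cnj (w $ i))"
    using assms by (auto simp: scalar_prod_def sum_distrib_right lessThan_atLeast0 intro!: sum.cong)
  also have "\<dots> = (\<Sum>j<m. \<Sum>i<n. A $$ (i, j) * x $ j * cnj (w $ i))"
    by (rule sum.swap)
  also have "\<dots> = x \<bullet>c (mat_adjoint A *\<^sub>v w)"
    using assms by (auto simp: scalar_prod_def sum_distrib_left lessThan_atLeast0 mult_ac intro!: sum.cong)
  finally show ?thesis .
qed

text \<open>Only the basis is fixed and the eigenvalues stay a parameter, because A, f(A) and the
  identity are all diagonal in the same basis.\<close>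

locale unitary_basis =
  fixes n :: nat and U :: "complex mat"
  assumes U: "U \<in> carrier_mat n n" and unitary: "mat_adjoint U * U = 1\<^sub>m n"
begin

definition coord :: "complex vec \<Rightarrow> nat \<Rightarrow> complex" where
  "coord v i = (mat_adjoint U *\<^sub>v v) $ i"

definition with_eigenvalues :: "(nat \<Rightarrow> real) \<Rightarrow> complex mat" where
  "with_eigenvalues f = U * mat_diag n (\<lambda>i. complex_of_real (f i)) * mat_adjoint U"

lemma Us: "mat_adjoint U \<in> carrier_mat n n"
  by (rule mat_adjoint_carrier[OF U])

lemma with_eigenvalues_carrier: "with_eigenvalues f \<in> carrier_mat n n"
  unfolding with_eigenvalues_def by (intro mult_carrier_mat[of _ n n] U Us mat_diag_dim)

lemma with_eigenvalues_dim[simp]: "dim_row (with_eigenvalues f) = n" "dim_col (with_eigenvalues f) = n"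
  using with_eigenvalues_carrier[of f] by auto

lemma with_eigenvalues_form:
  assumes v: "v \<in> carrier_vec n" and w: "w \<in> carrier_vec n"
  shows "(with_eigenvalues f *\<^sub>v v) \<bullet>c w = (\<Sum>i<n. complex_of_real (f i) * (coord v i * cnj (coord w i)))"
proof -
  let ?D = "mat_diag n (\<lambda>i. complex_of_real (f i))"
  have D: "?D \<in> carrier_mat n n" by simp
  have x: "mat_adjoint U *\<^sub>v v \<in> carrier_vec n" using Us v by auto
  have Dx: "(?D *\<^sub>v x) $ i = complex_of_real (f i) * x $ i" if "i < n" "x \<in> carrier_vec n" for x i
    using that by (simp add: mat_diag_def scalar_prod_def if_distrib[of "\<lambda>a. a * _"] cong: if_cong)
  have "with_eigenvalues f *\<^sub>v v = U *\<^sub>v (?D *\<^sub>v (mat_adjoint U *\<^sub>v v))"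
    unfolding with_eigenvalues_def using U Us D v x
    by (simp add: assoc_mult_mat_vec[of _ n n _ n])
  then have "(with_eigenvalues f *\<^sub>v v) \<bullet>c w = (?D *\<^sub>v (mat_adjoint U *\<^sub>v v)) \<bullet>c (mat_adjoint U *\<^sub>v w)"
    using mat_adjoint_sprod[OF U _ w] D x by (metis mult_mat_vec_carrier)
  also have "\<dots> = (\<Sum>i<n. complex_of_real (f i) * (coord v i * cnj (coord w i)))"
    using x Us v w U by (auto simp: scalar_prod_def[of _ "conjugate _"] Dx coord_def lessThan_atLeast0 mult_ac
        simp del: index_mult_mat_vec intro!: sum.cong)
  finally show ?thesis .
qed

lemma with_eigenvalues_quadratic_form:
  assumes v: "v \<in> carrier_vec n"
  shows "(with_eigenvalues f *\<^sub>v v) \<bullet>c v = complex_of_real (\<Sum>i<n. f i * (cmod (coord v i))\<^sup>2)"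
  using with_eigenvalues_form[OF v v, of f] by (simp flip: complex_norm_square)

text \<open>Parseval's identity, as the case of constant eigenvalue 1.\<close>

lemma sprod_coord:
  assumes v: "v \<in> carrier_vec n" and w: "w \<in> carrier_vec n"
  shows "v \<bullet>c w = (\<Sum>i<n. coord v i * cnj (coord w i))"
proof -
  have "with_eigenvalues (\<lambda>_. 1) = 1\<^sub>m n"
    using unitary_adjoint_right[OF U unitary] U by (simp add: with_eigenvalues_def)
  then show ?thesis using with_eigenvalues_form[OF v w, of "\<lambda>_. 1"] v by simp
qed

text \<open>Lets a vector be prescribed by its coordinates, so that a resolvent can be applied to a
  vector without forming an inverse matrix.\<close>

lemma coord_surj: "\<exists>w\<in>carrier_vec n. \<forall>i<n. coord w i = z i"
proof
  have "mat_adjoint U *\<^sub>v (U *\<^sub>v Matrix.vec n z) = Matrix.vec n z"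
    using U Us unitary by (simp flip: assoc_mult_mat_vec)
  then show "\<forall>i<n. coord (U *\<^sub>v Matrix.vec n z) i = z i"
    by (simp add: coord_def)
qed (use U in auto)

lemma with_eigenvalues_hermitian: "hermitian_mat (with_eigenvalues f)"
proof -
  let ?D = "mat_diag n (\<lambda>i. complex_of_real (f i))"
  have D: "mat_adjoint ?D = ?D" by (rule eq_matI) (auto simp: mat_diag_def)
  have "mat_adjoint (with_eigenvalues f) = mat_adjoint (mat_adjoint U) * mat_adjoint (U * ?D)"
    unfolding with_eigenvalues_def using U Us by (intro mat_adjoint_mult[of _ n n _ n]) auto
  also have "mat_adjoint (U * ?D) = ?D * mat_adjoint U"
    using mat_adjoint_mult[OF U, of ?D n] D by simp
  also have "mat_adjoint (mat_adjoint U) * (?D * mat_adjoint U) = with_eigenvalues f"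
    unfolding with_eigenvalues_def using U Us by (simp add: assoc_mult_mat[of _ n n _ n _ n])
  finally show ?thesis
    using with_eigenvalues_carrier[of f] unfolding hermitian_mat_def by auto
qed

text \<open>Carries the spectral hypotheses over to the eigenvalue lists. Column i of U is an
  eigenvector, non-zero because the i-th diagonal entry of \<open>mat_adjoint U * U\<close> is
  1.\<close>

lemma with_eigenvalues_spectrum:
  assumes i: "i < n"
  shows "complex_of_real (f i) \<in> spectrum (with_eigenvalues f)"
proof -
  let ?D = "mat_diag n (\<lambda>i. complex_of_real (f i))"
  have "with_eigenvalues f * U = U * ?D * (mat_adjoint U * U)"
    unfolding with_eigenvalues_def using U Us by (intro assoc_mult_mat[of _ n n _ n _ n]) auto
  then have AU: "with_eigenvalues f * U = U * ?D"
    using right_mult_one_mat[OF mult_carrier_mat[OF U mat_diag_dim]] by (simp add: unitary)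
  have "with_eigenvalues f *\<^sub>v col U i = col (with_eigenvalues f * U) i"
    by (rule col_mult2[symmetric, OF with_eigenvalues_carrier U i])
  also have "\<dots> = complex_of_real (f i) \<cdot>\<^sub>v col U i"
    unfolding AU mat_diag_mult_right[OF U] using U i by (intro eq_vecI) auto
  finally have "with_eigenvalues f *\<^sub>v col U i = complex_of_real (f i) \<cdot>\<^sub>v col U i" .
  moreover have "col U i \<noteq> 0\<^sub>v n"
  proof
    assume "col U i = 0\<^sub>v n"
    then have "(mat_adjoint U * U) $$ (i, i) = 0" using U i by (simp add: scalar_prod_def)
    then show False using i by (simp add: unitary)
  qed
  ultimately have "eigenvector (with_eigenvalues f) (col U i) (complex_of_real (f i))"
    using U i with_eigenvalues_carrier[of f] unfolding eigenvector_def by auto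
  then show ?thesis by (auto simp: spectrum_def eigenvalue_def)
qed

end

(* <v, M^-1 v> is the maximum over w of 2 Re <v, w> - <M w, w>; the maximizer w = (B + l)^-1 v for
   the larger matrix serves as a competitor for the smaller one. *)
lemma resolvent_form_antitone:
  assumes "unitary_basis n U" "unitary_basis n V"
    and le: "loewner_le (unitary_basis.with_eigenvalues n U d) (unitary_basis.with_eigenvalues n V e)"
    and pos: "\<And>i. i < n \<Longrightarrow> 0 < d i + l" "\<And>i. i < n \<Longrightarrow> 0 < e i + l"
    and v: "v \<in> carrier_vec n"
  shows "(\<Sum>i<n. (cmod (unitary_basis.coord V v i))\<^sup>2 / (e i + l)) \<le>
    (\<Sum>i<n. (cmod (unitary_basis.coord U v i))\<^sup>2 / (d i + l))"
proof -
  interpret A: unitary_basis n U by fact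
  interpret B: unitary_basis n V by fact
  obtain w where w: "w \<in> carrier_vec n" "\<And>i. i < n \<Longrightarrow> B.coord w i = B.coord v i / complex_of_real (e i + l)"
    using B.coord_surj[of "\<lambda>i. B.coord v i / complex_of_real (e i + l)"] by auto
  \<comment> \<open>Q is <v, w>, computed in the basis of B here and in that of A right below, and
    it is also <(B + l) w, w>. The two bases are thus compared only through v and w.\<close>
  define Q where "Q = (\<Sum>i<n. (cmod (B.coord v i))\<^sup>2 / (e i + l))"
  have "v \<bullet>c w = complex_of_real Q"
    unfolding B.sprod_coord[OF v w(1)] Q_def of_real_sum
    by (rule sum.cong) (simp_all add: w(2) flip: complex_norm_square)
  then have Q: "Q = (\<Sum>i<n. Re (A.coord v i * cnj (A.coord w i)))"
    by (simp add: A.sprod_coord[OF v w(1)] complex_eq_iff)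
  have "w \<bullet>c w = complex_of_real (\<Sum>i<n. (cmod (A.coord w i))\<^sup>2)"
    using A.sprod_coord[OF w(1) w(1)] by (simp flip: complex_norm_square)
  moreover have "w \<bullet>c w = complex_of_real (\<Sum>i<n. (cmod (B.coord w i))\<^sup>2)"
    using B.sprod_coord[OF w(1) w(1)] by (simp flip: complex_norm_square)
  \<comment> \<open>Equal norms in both bases allow l * |w|^2 to be added to both sides of <A w, w>
    <= <B w, w>.\<close>
  ultimately have norm: "(\<Sum>i<n. (cmod (A.coord w i))\<^sup>2) = (\<Sum>i<n. (cmod (B.coord w i))\<^sup>2)"
    using of_real_eq_iff by metis
  have "0 \<le> ((B.with_eigenvalues e - A.with_eigenvalues d) *\<^sub>v w) \<bullet>c w"
    using le w(1) A.with_eigenvalues_carrier[of d] unfolding loewner_le_def psd_mat_def by auto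
  also have "((B.with_eigenvalues e - A.with_eigenvalues d) *\<^sub>v w) \<bullet>c w =
    (B.with_eigenvalues e *\<^sub>v w) \<bullet>c w - (A.with_eigenvalues d *\<^sub>v w) \<bullet>c w"
    unfolding minus_mult_distrib_mat_vec[OF B.with_eigenvalues_carrier A.with_eigenvalues_carrier w(1)]
    by (rule minus_scalar_prod_distrib[of _ n])
      (use w(1) in \<open>auto intro: mult_mat_vec_carrier A.with_eigenvalues_carrier B.with_eigenvalues_carrier\<close>)
  finally have "(\<Sum>i<n. d i * (cmod (A.coord w i))\<^sup>2) \<le> (\<Sum>i<n. e i * (cmod (B.coord w i))\<^sup>2)"
    unfolding A.with_eigenvalues_quadratic_form[OF w(1)] B.with_eigenvalues_quadratic_form[OF w(1)]
    by (simp add: less_eq_complex_def)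
  then have "(\<Sum>i<n. (d i + l) * (cmod (A.coord w i))\<^sup>2) \<le> (\<Sum>i<n. (e i + l) * (cmod (B.coord w i))\<^sup>2)"
    using norm by (simp add: distrib_right sum.distrib flip: sum_distrib_left)
  also have "\<dots> = Q" unfolding Q_def
    by (rule sum.cong)
      (use pos(2) in \<open>auto simp: w(2) norm_divide power_divide power2_eq_square simp del: of_real_add\<close>)
  finally have AQ: "(\<Sum>i<n. (d i + l) * (cmod (A.coord w i))\<^sup>2) \<le> Q" .
  have "Q \<le> 2 * Q - (\<Sum>i<n. (d i + l) * (cmod (A.coord w i))\<^sup>2)" using AQ by simp
  also have "\<dots> = (\<Sum>i<n. 2 * Re (A.coord v i * cnj (A.coord w i)) - (d i + l) * (cmod (A.coord w i))\<^sup>2)"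
    unfolding Q by (simp add: sum_subtractf sum_distrib_left)
  also have "\<dots> \<le> (\<Sum>i<n. (cmod (A.coord v i))\<^sup>2 / (d i + l))"
  proof (rule sum_mono)
    fix i assume "i \<in> {..<n}"
    then have p: "0 < d i + l" using pos(1) by simp
    define s where "s = d i + l"
    have s: "0 < s" using p by (simp add: s_def)
    define a b where "a = cmod (A.coord v i)" and "b = cmod (A.coord w i)"
    have "Re (A.coord v i * cnj (A.coord w i)) \<le> a * b"
      using complex_Re_le_cmod[of "A.coord v i * cnj (A.coord w i)"] by (simp add: norm_mult a_def b_def)
    \<comment> \<open>The scalar form of the variational bound, by completing the square; equality
      holds at b = a / s.\<close>
    moreover have "2 * (a * b) - s * b\<^sup>2 \<le> a\<^sup>2 / s"
    proof -
      have "0 \<le> (a - s * b)\<^sup>2 / s" using s by simp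
      also have "\<dots> = a\<^sup>2 / s - 2 * (a * b) + s * b\<^sup>2"
        using s by (simp add: power2_eq_square field_simps)
      finally show ?thesis by simp
    qed
    ultimately show "2 * Re (A.coord v i * cnj (A.coord w i)) - (d i + l) * (cmod (A.coord w i))\<^sup>2
      \<le> (cmod (A.coord v i))\<^sup>2 / (d i + l)"
      unfolding a_def b_def s_def by linarith
  qed
  finally show ?thesis by (simp add: Q_def)
qed

text \<open>m and m' stand for the squared moduli of the coordinates of one vector in the eigenbases
  of A and B. Equality of their sums is Parseval; the resolvent inequality alone would give only one
  direction of it, as l tends to infinity.\<close>

lemma matrix_monotoneI:
  assumes I: "\<And>t. t \<in> I \<Longrightarrow> 0 < t"
    and mono: "\<And>m m' d e. (\<And>i. i < N \<Longrightarrow> d i \<in> I) \<Longrightarrow> (\<And>i. i < N \<Longrightarrow> e i \<in> I) \<Longrightarrow>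
      (\<Sum>i<N. m i) = (\<Sum>i<N. m' i) \<Longrightarrow>
      (\<And>l. 0 \<le> l \<Longrightarrow> (\<Sum>i<N. m' i / (e i + l)) \<le> (\<Sum>i<N. m i / (d i + l))) \<Longrightarrow>
      (\<Sum>i<N. m i * f (d i)) \<le> (\<Sum>i<N. m' i * f (e i) :: real)"
  shows "matrix_monotone N I f"
  unfolding matrix_monotone_def
proof (intro ballI impI)
  fix A B :: "complex mat"
  assume A: "A \<in> carrier_mat N N" "hermitian_mat A" "spectrum A \<subseteq> complex_of_real ` I"
    and B: "B \<in> carrier_mat N N" "hermitian_mat B" "spectrum B \<subseteq> complex_of_real ` I"
    and le: "loewner_le A B"
  obtain U d V e where Ud: "unitary_diagonalization A U d" and Ve: "unitary_diagonalization B V e"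
    using hermitian_unitary_diagonalization A B by meson
  interpret A: unitary_basis N U
    using Ud A by unfold_locales (auto simp: unitary_diagonalization_def unitary_mat_def)
  interpret B: unitary_basis N V
    using Ve B by unfold_locales (auto simp: unitary_diagonalization_def unitary_mat_def)
  have Aeq: "A = A.with_eigenvalues d" and Beq: "B = B.with_eigenvalues e"
    using Ud Ve A B by (auto simp: unitary_diagonalization_def A.with_eigenvalues_def B.with_eigenvalues_def)
  have fA: "mat_fun f A = A.with_eigenvalues (\<lambda>i. f (d i))"
    using mat_fun_eq[OF Ud] A by (simp add: A.with_eigenvalues_def)
  have fB: "mat_fun f B = B.with_eigenvalues (\<lambda>i. f (e i))"
    using mat_fun_eq[OF Ve] B by (simp add: B.with_eigenvalues_def)
  have d: "d i \<in> I" if "i < N" for i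
    using A.with_eigenvalues_spectrum[OF that, of d] A(3) unfolding Aeq[symmetric] by auto
  have e: "e i \<in> I" if "i < N" for i
    using B.with_eigenvalues_spectrum[OF that, of e] B(3) unfolding Beq[symmetric] by auto
  note fAc = A.with_eigenvalues_carrier[of "\<lambda>i. f (d i)"]
  note fBc = B.with_eigenvalues_carrier[of "\<lambda>i. f (e i)"]
  show "loewner_le (mat_fun f A) (mat_fun f B)"
    unfolding loewner_le_def psd_mat_def fA fB
  proof (intro conjI ballI)
    show "hermitian_mat (B.with_eigenvalues (\<lambda>i. f (e i)) - A.with_eigenvalues (\<lambda>i. f (d i)))"
      (is "hermitian_mat (?B - ?A)")
      unfolding hermitian_mat_def
    proof
      show "mat_adjoint (?B - ?A) = ?B - ?A"
      proof (rule eq_matI)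
        fix i j assume "i < dim_row (?B - ?A)" "j < dim_col (?B - ?A)"
        then have ij: "i < N" "j < N" using fAc by auto
        have "mat_adjoint ?A $$ (i, j) = ?A $$ (i, j)" "mat_adjoint ?B $$ (i, j) = ?B $$ (i, j)"
          using A.with_eigenvalues_hermitian B.with_eigenvalues_hermitian by (simp_all add: hermitian_mat_def)
        then show "mat_adjoint (?B - ?A) $$ (i, j) = (?B - ?A) $$ (i, j)"
          using ij fAc fBc by auto
      qed (use fAc in auto)
    qed (use fAc in auto)
    fix v :: "complex vec"
    assume "v \<in> carrier_vec (dim_row (B.with_eigenvalues (\<lambda>i. f (e i)) - A.with_eigenvalues (\<lambda>i. f (d i))))"
    then have v: "v \<in> carrier_vec N" using fAc by auto
    have "((?B - ?A) *\<^sub>v v) \<bullet>c v = (?B *\<^sub>v v) \<bullet>c v - (?A *\<^sub>v v) \<bullet>c v"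
      unfolding minus_mult_distrib_mat_vec[OF fBc fAc v]
      by (rule minus_scalar_prod_distrib[of _ N]) (use v in \<open>auto intro: mult_mat_vec_carrier[OF fAc] mult_mat_vec_carrier[OF fBc]\<close>)
    moreover have "(\<Sum>i<N. (cmod (A.coord v i))\<^sup>2 * f (d i)) \<le> (\<Sum>i<N. (cmod (B.coord v i))\<^sup>2 * f (e i))"
    proof (rule mono)
      have "complex_of_real (\<Sum>i<N. (cmod (A.coord v i))\<^sup>2) = complex_of_real (\<Sum>i<N. (cmod (B.coord v i))\<^sup>2)"
        using A.sprod_coord[OF v v] B.sprod_coord[OF v v] by (simp flip: complex_norm_square)
      then show "(\<Sum>i<N. (cmod (A.coord v i))\<^sup>2) = (\<Sum>i<N. (cmod (B.coord v i))\<^sup>2)"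
        using of_real_eq_iff by blast
      show "(\<Sum>i<N. (cmod (B.coord v i))\<^sup>2 / (e i + l)) \<le> (\<Sum>i<N. (cmod (A.coord v i))\<^sup>2 / (d i + l))"
        if "0 \<le> l" for l
        by (rule resolvent_form_antitone[OF A.unitary_basis_axioms B.unitary_basis_axioms _ _ _ v])
          (use le Aeq Beq I d e that in \<open>auto intro: add_pos_nonneg\<close>)
    qed (use d e in auto)
    ultimately show "0 \<le> ((?B - ?A) *\<^sub>v v) \<bullet>c v"
      unfolding A.with_eigenvalues_quadratic_form[OF v] B.with_eigenvalues_quadratic_form[OF v]
      by (simp add: less_eq_complex_def mult.commute)
  qed
qed

section \<open>From anti-Loewner inequalities to monotonicity in the squared variable\<close>

lemma anti_loewner_nonneg:
  assumes g: "anti_loewner n I g" and n: "0 < n" and I: "infinite I" "\<And>z. z \<in> I \<Longrightarrow> 0 < z" and x: "x \<in> I"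
  shows "0 \<le> g x"
  \<comment> \<open>The one-point kernel is 2 * g x / (2 * x), with x > 0.\<close>
  using anti_loewner_kernel_nonneg[OF g I(1), of "{x}" "\<lambda>_. 1"] I(2)[OF x] x n
  by (simp add: zero_le_divide_iff)

text \<open>The order 2N is spent here: N nodes with coefficients - c and N with coefficients c'.
  Indexing by a disjoint sum keeps both entries when a node occurs on both sides.\<close>

lemma anti_loewner_sum_le:
  fixes c c' d e :: "nat \<Rightarrow> real"
  assumes g: "anti_loewner (2 * N) I g" and I: "infinite I" "\<And>z. z \<in> I \<Longrightarrow> 0 < z"
    and x: "\<And>i. i < N \<Longrightarrow> x i \<in> I" and y: "\<And>i. i < N \<Longrightarrow> y i \<in> I"
    and test: "\<And>l. 0 \<le> l \<Longrightarrow>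
      (\<Sum>i<N. c i * (x i / ((x i)\<^sup>2 + l))) \<le> (\<Sum>i<N. c' i * (y i / ((y i)\<^sup>2 + l)))"
  shows "(\<Sum>i<N. c i * g (x i)) \<le> (\<Sum>i<N. c' i * g (y i))"
proof -
  have "0 \<le> (\<Sum>k\<in>{..<N} <+> {..<N}. case_sum (\<lambda>i. - c i) c' k * g (case_sum x y k))"
  proof (rule anti_loewner_sum_nonneg[OF g I])
    fix l :: real assume "0 \<le> l"
    then show "0 \<le> (\<Sum>k\<in>{..<N} <+> {..<N}. case_sum (\<lambda>i. - c i) c' k *
      (case_sum x y k / ((case_sum x y k)\<^sup>2 + l)))"
      using test[of l] by (subst sum.Plus) (simp_all add: sum_negf)
  qed (use x y in \<open>auto simp: card_Plus\<close>)
  then show ?thesis by (subst (asm) sum.Plus) (simp_all add: sum_negf)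
qed

theorem theorem2p1:
  fixes a :: real and b :: ereal and g :: "real \<Rightarrow> real" and N :: nat
  assumes "0 \<le> a" and "ereal a < b"
    and "N \<ge> 2"
    and "anti_loewner (2 * N) (einterval (ereal a) b) g"
  shows "(\<forall>t\<in>einterval (ereal (a\<^sup>2)) (b\<^sup>2). 0 \<le> g (sqrt t) * sqrt t) \<and>
         matrix_monotone N (einterval (ereal (a\<^sup>2)) (b\<^sup>2)) (\<lambda>t. g (sqrt t) * sqrt t) \<and>
         (\<forall>t\<in>einterval (ereal (a\<^sup>2)) (b\<^sup>2). 0 \<le> g (sqrt t) / sqrt t) \<and>
         matrix_monotone_decreasing N (einterval (ereal (a\<^sup>2)) (b\<^sup>2)) (\<lambda>t. g (sqrt t) / sqrt t)"
proof -
  define I where "I = einterval (ereal a) b"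
  define I2 where "I2 = einterval (ereal (a\<^sup>2)) (b\<^sup>2)"
  have g: "anti_loewner (2 * N) I g" using assms(4) by (simp add: I_def)
  have pos: "0 < z" if "z \<in> I" for z using that assms(1) by (auto simp: I_def einterval_def)
  have "infinite I"
  proof -
    obtain r where r: "ereal a < ereal r" "ereal r < b" using ereal_dense2[OF assms(2)] by auto
    then have "{a<..<r} \<subseteq> I"
      unfolding I_def einterval_def by (auto intro: less_trans[of "ereal _" "ereal r" b])
    moreover have "infinite {a<..<r}" using infinite_Ioo[of a r] r by simp
    ultimately show ?thesis using finite_subset by blast
  qed
  note I = this pos
  have pos2: "0 < t" if "t \<in> I2" for t
    using that by (auto simp: I2_def einterval_def intro: le_less_trans[OF zero_le_power2[of a]])
  have sqrt_I: "sqrt t \<in> I" if t: "t \<in> I2" for t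
  proof -
    have "a < sqrt t" using t assms(1) by (auto simp: I2_def einterval_def intro: real_less_rsqrt)
    \<comment> \<open>For finite b = r, the bound t < r^2 gives sqrt t < r because 0 <= a <
      r.\<close>
    moreover have "ereal (sqrt t) < b"
    proof (cases b)
      case (real r)
      then have "a < r" using assms(2) by simp
      moreover have "t < r\<^sup>2" using t by (simp add: I2_def einterval_def real)
      ultimately show ?thesis using assms(1) by (simp add: real real_less_lsqrt)
    qed (use assms(2) in auto)
    ultimately show ?thesis by (simp add: I_def einterval_def)
  qed
  have nonneg: "0 \<le> g (sqrt t)" if "t \<in> I2" for t
    using anti_loewner_nonneg[OF g _ I sqrt_I[OF that]] assms(3) by simp
  have "matrix_monotone N I2 (\<lambda>t. g (sqrt t) * sqrt t)"
  proof (rule matrix_monotoneI[OF pos2])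
    fix m m' d e :: "nat \<Rightarrow> real"
    assume d: "\<And>i. i < N \<Longrightarrow> d i \<in> I2" and e: "\<And>i. i < N \<Longrightarrow> e i \<in> I2"
      and m: "(\<Sum>i<N. m i) = (\<Sum>i<N. m' i)"
      and le: "\<And>l. 0 \<le> l \<Longrightarrow> (\<Sum>i<N. m' i / (e i + l)) \<le> (\<Sum>i<N. m i / (d i + l))"
    have "(\<Sum>i<N. m i * sqrt (d i) * g (sqrt (d i))) \<le> (\<Sum>i<N. m' i * sqrt (e i) * g (sqrt (e i)))"
    proof (rule anti_loewner_sum_le[OF g I])
      fix l :: real assume l: "0 \<le> l"
      \<comment> \<open>With weight sqrt t the test function becomes t / (t + l) = 1 - l / (t + l).
        The constant part is settled by the equal sums, the rest by l times the resolvent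
        inequality.\<close>
      have expand: "(\<Sum>i<N. k i * sqrt (t i) * (sqrt (t i) / ((sqrt (t i))\<^sup>2 + l))) =
          (\<Sum>i<N. k i) - l * (\<Sum>i<N. k i / (t i + l))" if t: "\<And>i. i < N \<Longrightarrow> t i \<in> I2" for k t
        unfolding sum_distrib_left sum_subtractf[symmetric]
      proof (rule sum.cong[OF refl])
        fix i assume "i \<in> {..<N}"
        then have "0 < t i" using pos2 t by auto
        then show "k i * sqrt (t i) * (sqrt (t i) / ((sqrt (t i))\<^sup>2 + l)) = k i - l * (k i / (t i + l))"
          using l by (simp add: field_simps)
      qed
      show "(\<Sum>i<N. m i * sqrt (d i) * (sqrt (d i) / ((sqrt (d i))\<^sup>2 + l))) \<le>
          (\<Sum>i<N. m' i * sqrt (e i) * (sqrt (e i) / ((sqrt (e i))\<^sup>2 + l)))"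
        using mult_left_mono[OF le[OF l] l] by (simp only: expand d e m)
    qed (use d e sqrt_I in auto)
    then show "(\<Sum>i<N. m i * (g (sqrt (d i)) * sqrt (d i))) \<le> (\<Sum>i<N. m' i * (g (sqrt (e i)) * sqrt (e i)))"
      by (simp add: mult_ac)
  qed
  moreover have "matrix_monotone N I2 (\<lambda>t. - (g (sqrt t) / sqrt t))"
  proof (rule matrix_monotoneI[OF pos2])
    fix m m' d e :: "nat \<Rightarrow> real"
    assume d: "\<And>i. i < N \<Longrightarrow> d i \<in> I2" and e: "\<And>i. i < N \<Longrightarrow> e i \<in> I2"
      and le: "\<And>l. 0 \<le> l \<Longrightarrow> (\<Sum>i<N. m' i / (e i + l)) \<le> (\<Sum>i<N. m i / (d i + l))"
    \<comment> \<open>With weight 1 / sqrt t the test function becomes 1 / (t + l), so the test is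
      \<open>le\<close> itself. The primed side is the smaller one, hence the decrease.\<close>
    have "(\<Sum>i<N. m' i / sqrt (e i) * g (sqrt (e i))) \<le> (\<Sum>i<N. m i / sqrt (d i) * g (sqrt (d i)))"
    proof (rule anti_loewner_sum_le[OF g I])
      fix l :: real assume l: "0 \<le> l"
      have expand: "(\<Sum>i<N. k i / sqrt (t i) * (sqrt (t i) / ((sqrt (t i))\<^sup>2 + l))) =
          (\<Sum>i<N. k i / (t i + l))" if t: "\<And>i. i < N \<Longrightarrow> t i \<in> I2" for k t
        by (rule sum.cong[OF refl]) (use pos2 t in \<open>force simp: less_imp_le\<close>)
      show "(\<Sum>i<N. m' i / sqrt (e i) * (sqrt (e i) / ((sqrt (e i))\<^sup>2 + l))) \<le>
          (\<Sum>i<N. m i / sqrt (d i) * (sqrt (d i) / ((sqrt (d i))\<^sup>2 + l)))"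
        using le[OF l] by (simp only: expand d e)
    qed (use d e sqrt_I in auto)
    then show "(\<Sum>i<N. m i * - (g (sqrt (d i)) / sqrt (d i))) \<le> (\<Sum>i<N. m' i * - (g (sqrt (e i)) / sqrt (e i)))"
      by (simp add: sum_negf)
  qed
  ultimately show ?thesis
    unfolding matrix_monotone_decreasing_def I2_def[symmetric]
    using nonneg pos2 by (auto intro!: mult_nonneg_nonneg divide_nonneg_nonneg simp: less_imp_le)
qed

end
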